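(* Let $\mathsf P$ be a piece with basic move set $\mathcal M$ where $|\mathcal M|\ge 2$, let $\mathcal B$ be a rational convex polygon, $q\ge1$, and $t$ a positive integer. For nonattacking labelled configurations $\mathbf z,\mathbf z'\in(t\mathcal B^\circ\cap\mathbb Z^2)^q$, $\mathbf z$ and $\mathbf z'$ are isotopic if and only if they are discretely isotopic. That is, isotopy and discrete isotopy produce the same equivalence relation on nonattacking configurations.
   Context: $\mathcal M$ is a nonempty finite set of nonzero vectors $m=(c,d)\in\mathbb Z^2$ with $\gcd(c,d)=1$, no two parallel; $m^\perp=(d,-c)$. $\mathcal B\subset\mathbb R^2$ is a closed two-dimensional convex polygon with rational vertices and interior $\mathcal B^\circ$. The move hyperplanes in $\mathbb R^{2q}$ (coordinates $\mathbf w=(w_1,\dots,w_q)$, $w_i\in\mathbb R^2$) are $\mathcal H^m_{ij}=\{(w_j-w_i)\cdot m^\perp=0\}$, $i<j$, $m\in\mathcal M$. A point $\mathbf w$ is nonattacking if it lies on no move hyperplane; its combinatorial type is the family of sets $L_{im}=\{j:(w_j-w_i)\cdot m^\perp>0\}$, $i=1,\dots,q$, $m\in\mathcal M$. Two configurations $\mathbf z,\mathbf z'$ are isotopic if there is a continuous path in $\mathbb R^{2q}$ from $\mathbf z$ to $\mathbf z'$ that never meets a move hyperplane. They are discretely isotopic if there exist a positive integer $s$ and a finite sequence $\mathbf z=\mathbf w^0,\mathbf w^1,\dots,\mathbf w^l=\mathbf z'$ of nonattacking points of $(t\mathcal B^\circ)^q\cap s^{-1}\mathbb Z^{2q}$,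 all having the same combinatorial type, such that each step $\mathbf w^{h-1}\to\mathbf w^h$ changes the position of a single piece only, by an integer multiple of $s^{-1}m$ for some $m\in\mathcal M$ (a legal move on the refined lattice). *)

theory Defs
  imports "HOL-Analysis.Analysis"
begin

definition move_vec :: "int ^ 2 \<Rightarrow> real ^ 2" where
  "move_vec m = (\<chi> k. real_of_int (m $ k))"

definition move_perp :: "int ^ 2 \<Rightarrow> real ^ 2" where
  "move_perp m = vector [real_of_int (m $ 2), - real_of_int (m $ 1)]"

text \<open>All members of a move set are nonzero, so the existence of a real scalar is a
  symmetric condition and expresses that the two vectors are parallel.\<close>

definition basic_move_set :: "(int ^ 2) set \<Rightarrow> bool" where
  "basic_move_set M \<longleftrightarrow>
     finite M \<and> M \<noteq> {} \<and>
     (\<forall>m\<in>M. m \<noteq> 0 \<and> gcd (m $ 1) (m $ 2) = 1) \<and>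
     (\<forall>m\<in>M. \<forall>m'\<in>M. m \<noteq> m' \<longrightarrow> \<not> (\<exists>r::real. move_vec m' = r *\<^sub>R move_vec m))"

definition rational_convex_polygon :: "(real ^ 2) set \<Rightarrow> bool" where
  "rational_convex_polygon B \<longleftrightarrow>
     polytope B \<and> aff_dim B = 2 \<and>
     (\<forall>v. v extreme_point_of B \<longrightarrow> (\<forall>k. v $ k \<in> \<rat>))"

text \<open>A configuration of \<open>q\<close> labelled pieces is an element of \<open>'q config\<close>, with the
  linearly ordered finite index type \<open>'q\<close> in the role of \<open>{1, \<dots>, q}\<close>. As a topological space
  this type is the Euclidean space of dimension \<open>2q\<close>.\<close>

type_synonym 'q config = "(real ^ 2, 'q) vec"

definition move_hyperplane ::
    "'q \<Rightarrow> 'q \<Rightarrow> int ^ 2 \<Rightarrow> ('q::{finite,linorder}) config set" where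
  "move_hyperplane i j m = {w. (w $ j - w $ i) \<bullet> move_perp m = 0}"

definition move_hyperplanes ::
    "(int ^ 2) set \<Rightarrow> ('q::{finite,linorder}) config set set" where
  "move_hyperplanes M = {move_hyperplane i j m | i j m. i < j \<and> m \<in> M}"

definition nonattacking :: "(int ^ 2) set \<Rightarrow> ('q::{finite,linorder}) config \<Rightarrow> bool" where
  "nonattacking M w \<longleftrightarrow> (\<forall>H\<in>move_hyperplanes M. w \<notin> H)"

definition comb_set :: "('q::{finite,linorder}) config \<Rightarrow> 'q \<Rightarrow> int ^ 2 \<Rightarrow> 'q set" where
  "comb_set w i m = {j. (w $ j - w $ i) \<bullet> move_perp m > 0}"

text \<open>The family is indexed only by the moves in \<open>M\<close>, hence the restriction.\<close>

definition comb_type ::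
    "(int ^ 2) set \<Rightarrow> ('q::{finite,linorder}) config \<Rightarrow> 'q \<times> (int ^ 2) \<Rightarrow> 'q set" where
  "comb_type M w = (\<lambda>(i, m)\<in>UNIV \<times> M. comb_set w i m)"

text \<open>The path may leave the board.\<close>

definition isotopic ::
    "(int ^ 2) set \<Rightarrow> ('q::{finite,linorder}) config \<Rightarrow> 'q config \<Rightarrow> bool" where
  "isotopic M z z' \<longleftrightarrow>
     (\<exists>\<gamma>. path \<gamma> \<and> pathstart \<gamma> = z \<and> pathfinish \<gamma> = z' \<and>
          (\<forall>H\<in>move_hyperplanes M. path_image \<gamma> \<inter> H = {}))"

definition open_board :: "nat \<Rightarrow> (real ^ 2) set \<Rightarrow> (real ^ 2) set" where
  "open_board t B = (\<lambda>x. real t *\<^sub>R x) ` interior B"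

definition refined_lattice :: "nat \<Rightarrow> (real ^ 2) set" where
  "refined_lattice s = {x. \<exists>v::int ^ 2. x = (1 / real s) *\<^sub>R move_vec v}"

text \<open>Intermediate configurations of the sequence must be nonattacking, but the straight
  segment traversed by a single step is not constrained.\<close>

definition legal_step ::
    "(int ^ 2) set \<Rightarrow> nat \<Rightarrow> ('q::{finite,linorder}) config \<Rightarrow> 'q config \<Rightarrow> bool" where
  "legal_step M s w w' \<longleftrightarrow>
     (\<exists>i. \<exists>m\<in>M. \<exists>k::int. k \<noteq> 0 \<and>
        w' $ i = w $ i + (real_of_int k / real s) *\<^sub>R move_vec m \<and>
        (\<forall>j. j \<noteq> i \<longrightarrow> w' $ j = w $ j))"

definition discretely_isotopic ::
    "(int ^ 2) set \<Rightarrow> (real ^ 2) set \<Rightarrow> nat \<Rightarrow>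
      ('q::{finite,linorder}) config \<Rightarrow> 'q config \<Rightarrow> bool" where
  "discretely_isotopic M B t z z' \<longleftrightarrow>
     (\<exists>s>0. \<exists>l. \<exists>w :: nat \<Rightarrow> 'q config.
        w 0 = z \<and> w l = z' \<and>
        (\<forall>h\<le>l. nonattacking M (w h) \<and>
               (\<forall>i. w h $ i \<in> open_board t B \<inter> refined_lattice s) \<and>
               comb_type M (w h) = comb_type M z) \<and>
        (\<forall>h<l. legal_step M s (w h) (w (Suc h))))"

definition nonattacking_configs ::
    "(int ^ 2) set \<Rightarrow> (real ^ 2) set \<Rightarrow> nat \<Rightarrow> ('q::{finite,linorder}) config set" where
  "nonattacking_configs M B t =
     {z. nonattacking M z \<and> (\<forall>i. z $ i \<in> open_board t B \<inter> refined_lattice 1)}"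

definition isotopy_rel ::
    "(int ^ 2) set \<Rightarrow> (real ^ 2) set \<Rightarrow> nat \<Rightarrow> ('q::{finite,linorder}) config rel" where
  "isotopy_rel M B t =
     {(z, z'). z \<in> nonattacking_configs M B t \<and> z' \<in> nonattacking_configs M B t \<and>
               isotopic M z z'}"

definition discrete_isotopy_rel ::
    "(int ^ 2) set \<Rightarrow> (real ^ 2) set \<Rightarrow> nat \<Rightarrow> ('q::{finite,linorder}) config rel" where
  "discrete_isotopy_rel M B t =
     {(z, z'). z \<in> nonattacking_configs M B t \<and> z' \<in> nonattacking_configs M B t \<and>
               discretely_isotopic M B t z z'}"

end

theory Submission
  imports Defs
begin

text \<open>The configurations of a given combinatorial type form an open convex cell, and so do those
  whose pieces lie on the open board. An isotopy cannot leave its cell, by the intermediate value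
  theorem; conversely a cell contains the segment between any two of its points. For the discrete
  version, two independent moves \<open>m\<^sub>1\<close>, \<open>m\<^sub>2\<close> of determinant \<open>\<plusminus>d\<close> express every integer
  displacement with coefficients in \<open>d\<^sup>-\<^sup>1\<int>\<close>. Cutting the segment into \<open>n\<close> equal parts and
  replacing each part by moves of one piece at a time along \<open>m\<^sub>1\<close> and then \<open>m\<^sub>2\<close> gives legal moves
  on the lattice of denominator \<open>nd\<close> that deviate from the segment by \<open>O(1/n)\<close>, hence stay
  in the cell once \<open>n\<close> is large.\<close>

section \<open>Separation functionals and combinatorial types as sign patterns\<close>

definition separation :: "'q \<Rightarrow> 'q \<Rightarrow> int ^ 2 \<Rightarrow> ('q::{finite,linorder}) config \<Rightarrow> real" where
  "separation i j m w = (w $ j - w $ i) \<bullet> move_perp m"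

lemma separation_linear: "linear (separation i j m)"
  by (rule linearI) (simp_all add: separation_def inner_simps algebra_simps)

lemma continuous_on_separation: "continuous_on S (separation i j m)"
  unfolding separation_def by (intro continuous_intros)

lemma separation_swap: "separation j i m w = - separation i j m w"
  by (simp add: separation_def inner_simps)

lemma nonattacking_iff:
  "nonattacking M w \<longleftrightarrow> (\<forall>i j. i < j \<longrightarrow> (\<forall>m\<in>M. separation i j m w \<noteq> 0))"
proof -
  have "nonattacking M w \<longleftrightarrow> (\<forall>i j. i < j \<longrightarrow> (\<forall>m\<in>M. w \<notin> move_hyperplane i j m))"
    unfolding nonattacking_def move_hyperplanes_def by blast
  then show ?thesis by (simp add: move_hyperplane_def separation_def)
qed

lemma comb_type_eq_iff:
  "comb_type M w = comb_type M z \<longleftrightarrow>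
    (\<forall>i j. \<forall>m\<in>M. 0 < separation i j m w \<longleftrightarrow> 0 < separation i j m z)"
proof -
  have "comb_type M w = comb_type M z \<longleftrightarrow> (\<forall>i. \<forall>m\<in>M. comb_set w i m = comb_set z i m)"
    unfolding comb_type_def restrict_def fun_eq_iff by auto
  then show ?thesis
    unfolding comb_set_def separation_def set_eq_iff by blast
qed

text \<open>Swapping \<open>i\<close> and \<open>j\<close> negates the functional, so the types
  record its full sign, and the pairs \<open>i < j\<close> suffice. As no value at \<open>z\<close>
  vanishes, agreement of signs is positivity of a product. For fixed \<open>z\<close> this is a
  strict linear inequality in \<open>w\<close>, the form from which convexity and openness are read
  off.\<close>

lemma comb_type_eq_iff_same_sign:
  fixes z w :: "('q::{finite,linorder}) config"
  assumes "nonattacking M z"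
  shows "comb_type M w = comb_type M z \<longleftrightarrow>
    (\<forall>i j. i < j \<longrightarrow> (\<forall>m\<in>M. 0 < separation i j m z * separation i j m w))"
    (is "?L \<longleftrightarrow> ?R")
proof
  assume L: ?L
  show ?R
  proof (intro allI impI ballI)
    fix i j :: 'q and m assume "i < j" "m \<in> M"
    then have "separation i j m z \<noteq> 0"
      using assms nonattacking_iff by blast
    moreover have "0 < separation i j m w \<longleftrightarrow> 0 < separation i j m z"
      "0 < separation j i m w \<longleftrightarrow> 0 < separation j i m z"
      using L \<open>m \<in> M\<close> unfolding comb_type_eq_iff by simp_all
    ultimately show "0 < separation i j m z * separation i j m w"
      by (auto simp: separation_swap[of j i] zero_less_mult_iff)
  qed
next
  assume R: ?R
  show ?L
    unfolding comb_type_eq_iff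
  proof (intro allI ballI)
    fix i j :: 'q and m assume m: "m \<in> M"
    consider "i < j" | "i = j" | "j < i" by (rule linorder_cases)
    then show "0 < separation i j m w \<longleftrightarrow> 0 < separation i j m z"
    proof cases
      case 1
      then have "0 < separation i j m z * separation i j m w"
        using R m by blast
      then show ?thesis
        by (auto simp: zero_less_mult_iff)
    next
      case 2
      then show ?thesis by (simp add: separation_def)
    next
      case 3
      then have "0 < separation j i m z * separation j i m w"
        using R m by blast
      then show ?thesis
        by (auto simp: separation_swap[of i j] zero_less_mult_iff)
    qed
  qed
qed

lemma nonattacking_comb_type_cong:
  assumes "nonattacking M z" "comb_type M w = comb_type M z"
  shows "nonattacking M w"
  using assms unfolding comb_type_eq_iff_same_sign[OF assms(1)] nonattacking_iff
  by fastforce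

section \<open>Cells of the move arrangement and isotopy\<close>

definition type_cell :: "(int ^ 2) set \<Rightarrow> ('q::{finite,linorder}) config \<Rightarrow> 'q config set" where
  "type_cell M z = {w. comb_type M w = comb_type M z}"

lemma type_cell_eq:
  assumes "nonattacking M z"
  shows "type_cell M z =
    (\<Inter>i. \<Inter>j\<in>{i<..}. \<Inter>m\<in>M. {w. 0 < separation i j m z * separation i j m w})"
  unfolding type_cell_def comb_type_eq_iff_same_sign[OF assms] by auto

text \<open>The cell of a nonattacking \<open>z\<close> is an intersection of open half-spaces, each
  the preimage of a ray under a linear functional.\<close>

lemma convex_type_cell:
  assumes "nonattacking M z"
  shows "convex (type_cell M z)"
proof -
  have "convex {w. 0 < separation i j m z * separation i j m w}" for i j m
  proof -
    have "linear (\<lambda>w. separation i j m z * separation i j m w)"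
      by (rule linearI)
        (simp_all add: linear_add[OF separation_linear] linear_scale[OF separation_linear]
          algebra_simps)
    then have "convex ((\<lambda>w. separation i j m z * separation i j m w) -` {0<..})"
      by (rule convex_linear_vimage) simp
    then show ?thesis by (simp add: vimage_def)
  qed
  then show ?thesis
    unfolding type_cell_eq[OF assms] by (intro convex_INT) blast
qed

text \<open>Finitely many pieces and moves make the intersection of half-spaces finite.\<close>

lemma open_type_cell:
  assumes "nonattacking M z" "finite M"
  shows "open (type_cell M z)"
  unfolding type_cell_eq[OF assms(1)] using assms(2)
  by (intro open_INT ballI open_Collect_less continuous_intros continuous_on_separation) auto

lemma isotopic_iff_comb_type_eq:
  assumes z: "nonattacking M z"
  shows "isotopic M z z' \<longleftrightarrow> comb_type M z' = comb_type M z"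
proof
  assume "isotopic M z z'"
  then obtain \<gamma> where \<gamma>: "path \<gamma>" "pathstart \<gamma> = z" "pathfinish \<gamma> = z'"
    and disj: "\<forall>H\<in>move_hyperplanes M. path_image \<gamma> \<inter> H = {}"
    unfolding isotopic_def by blast
  have ends: "z \<in> path_image \<gamma>" "z' \<in> path_image \<gamma>"
    using \<gamma> pathstart_in_path_image pathfinish_in_path_image by metis+
  have "0 < separation i j m z * separation i j m z'" if "i < j" "m \<in> M" for i j m
  proof (rule ccontr)
    let ?I = "separation i j m ` path_image \<gamma>"
    assume "\<not> 0 < separation i j m z * separation i j m z'"
    \<comment> \<open>A nonpositive product means that the values at the two ends lie weakly on
      opposite sides of 0, so the connected image \<open>?I\<close> contains 0.\<close>
    then have "separation i j m z \<le> 0 \<and> 0 \<le> separation i j m z' \<or>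
        separation i j m z' \<le> 0 \<and> 0 \<le> separation i j m z"
      by (auto simp: zero_less_mult_iff not_less)
    moreover have "connected ?I"
      by (intro connected_continuous_image continuous_on_separation connected_path_image \<gamma>)
    ultimately have "0 \<in> ?I"
      using ends connectedD_interval[of ?I] by blast
    then obtain w where "w \<in> path_image \<gamma>" "separation i j m w = 0" by auto
    then have "w \<in> path_image \<gamma> \<inter> move_hyperplane i j m"
      by (simp add: move_hyperplane_def separation_def)
    then show False
      using disj that unfolding move_hyperplanes_def by blast
  qed
  then show "comb_type M z' = comb_type M z"
    using comb_type_eq_iff_same_sign[OF z] by blast
next
  assume "comb_type M z' = comb_type M z"
  then have "closed_segment z z' \<subseteq> type_cell M z"
    by (intro closed_segment_subset convex_type_cell z) (simp_all add: type_cell_def)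
  then have "\<forall>w \<in> closed_segment z z'. nonattacking M w"
    using nonattacking_comb_type_cong[OF z] by (auto simp: type_cell_def)
  then have "\<forall>H\<in>move_hyperplanes M. path_image (linepath z z') \<inter> H = {}"
    unfolding nonattacking_def path_image_linepath by blast
  then show "isotopic M z z'"
    unfolding isotopic_def
    by (intro exI[of _ "linepath z z'"]) simp
qed

section \<open>Refined lattices and chains of legal moves\<close>

lemma move_vec_add: "move_vec (u + v) = move_vec u + move_vec v"
  by (simp add: move_vec_def vec_eq_iff)

lemma move_vec_diff: "move_vec (u - v) = move_vec u - move_vec v"
  by (simp add: move_vec_def vec_eq_iff)

lemma move_vec_smult: "move_vec (\<chi> i. k * v $ i) = real_of_int k *\<^sub>R move_vec v"
  by (simp add: move_vec_def vec_eq_iff)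

lemma refined_lattice_move:
  assumes "x \<in> refined_lattice s"
  shows "x + (real_of_int k / real s) *\<^sub>R move_vec m \<in> refined_lattice s"
proof -
  obtain v where "x = (1 / real s) *\<^sub>R move_vec v"
    using assms by (auto simp: refined_lattice_def)
  then have "x + (real_of_int k / real s) *\<^sub>R move_vec m =
      (1 / real s) *\<^sub>R move_vec (v + (\<chi> i. k * m $ i))"
    by (simp add: move_vec_add move_vec_smult scaleR_add_right)
  then show ?thesis
    unfolding refined_lattice_def by blast
qed

lemma refined_lattice_1_subset:
  assumes "s > 0"
  shows "refined_lattice 1 \<subseteq> refined_lattice s"
proof
  fix x assume "x \<in> refined_lattice 1"
  then obtain v where "x = move_vec v" by (auto simp: refined_lattice_def)
  then have "x = (1 / real s) *\<^sub>R move_vec (\<chi> i. int s * v $ i)"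
    using assms by (simp add: move_vec_smult)
  then show "x \<in> refined_lattice s"
    unfolding refined_lattice_def by blast
qed

lemma legal_step_refined_lattice:
  assumes "legal_step M s w w'" "\<forall>i. w $ i \<in> refined_lattice s"
  shows "\<forall>i. w' $ i \<in> refined_lattice s"
  using assms unfolding legal_step_def by (metis refined_lattice_move)

text \<open>A relation lets chains be concatenated through its reflexive transitive closure. Only
  the target is required to lie in \<open>U\<close>; the start of a chain is checked separately.
  Lattice membership is left out because legal moves preserve it.\<close>

definition legal_step_rel ::
    "(int ^ 2) set \<Rightarrow> nat \<Rightarrow> ('q::{finite,linorder}) config set \<Rightarrow> 'q config rel" where
  "legal_step_rel M s U = {(w, w'). legal_step M s w w' \<and> w' \<in> U}"

text \<open>The pieces move one after another, and \<open>A\<close> is the set of those already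
  moved. The induction on finite sets fixes no order of the pieces, so \<open>U\<close> has to
  contain the partial configuration for every \<open>A\<close>.\<close>

lemma legal_steps_all_pieces:
  fixes w :: "('q::{finite,linorder}) config" and a :: "'q \<Rightarrow> int"
  assumes m: "m \<in> M"
    and U: "\<And>A. (\<chi> i. w $ i + (if i \<in> A then (real_of_int (a i) / real s) *\<^sub>R move_vec m else 0)) \<in> U"
  shows "(w, \<chi> i. w $ i + (real_of_int (a i) / real s) *\<^sub>R move_vec m) \<in> (legal_step_rel M s U)\<^sup>*"
proof -
  define moved where "moved A = (\<chi> i. w $ i +
    (if i \<in> A then (real_of_int (a i) / real s) *\<^sub>R move_vec m else 0))" for A
  have moved_U: "moved A \<in> U" for A
    unfolding moved_def by (rule U)
  have "(w, moved A) \<in> (legal_step_rel M s U)\<^sup>*" for A :: "'q set"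
    using finite[of A]
  proof (induction A rule: finite_induct)
    case empty
    have "moved {} = w" by (simp add: moved_def vec_eq_iff)
    then show ?case by simp
  next
    case (insert i A)
    show ?case
    proof (cases "a i = 0")
      \<comment> \<open>A legal step needs a nonzero multiple; a piece with coefficient 0
        contributes no step.\<close>
      case True
      then have "moved (insert i A) = moved A"
        by (simp add: moved_def vec_eq_iff)
      then show ?thesis using insert.IH by simp
    next
      case False
      then have "legal_step M s (moved A) (moved (insert i A))"
        unfolding legal_step_def using insert.hyps m
        by (intro exI[of _ i] bexI[of _ m] exI[of _ "a i"]) (auto simp: moved_def)
      then have "(moved A, moved (insert i A)) \<in> legal_step_rel M s U"
        using moved_U by (simp add: legal_step_rel_def)
      then show ?thesis using insert.IH by simp
    qed
  qed
  from this[of UNIV] show ?thesis by (simp add: moved_def)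
qed

lemma norm_le_sum_norm_nth:
  fixes x :: "('a::real_normed_vector) ^ 'n"
  shows "norm x \<le> (\<Sum>i\<in>UNIV. norm (x $ i))"
  unfolding norm_vec_def by (rule L2_set_le_sum) simp

text \<open>First all pieces move along \<open>m1\<close>, then all along \<open>m2\<close>. At
  every moment piece \<open>i\<close> is displaced from \<open>w $ i\<close> by at most the sum of
  the lengths of its two moves, so the whole chain stays in the ball.\<close>

lemma legal_steps_two_moves:
  fixes w :: "('q::{finite,linorder}) config" and a b :: "'q \<Rightarrow> int"
  assumes m: "m1 \<in> M" "m2 \<in> M"
    and ball: "ball w e \<subseteq> U"
    and small: "(\<Sum>i\<in>UNIV. norm ((real_of_int (a i) / real s) *\<^sub>R move_vec m1) +
        norm ((real_of_int (b i) / real s) *\<^sub>R move_vec m2)) < e"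
  shows "(w, \<chi> i. w $ i + (real_of_int (a i) / real s) *\<^sub>R move_vec m1 +
      (real_of_int (b i) / real s) *\<^sub>R move_vec m2) \<in> (legal_step_rel M s U)\<^sup>*"
proof -
  define u v where "u = (\<lambda>i. (real_of_int (a i) / real s) *\<^sub>R move_vec m1)"
    and "v = (\<lambda>i. (real_of_int (b i) / real s) *\<^sub>R move_vec m2)"
  define w1 where "w1 = (\<chi> i. w $ i + u i)"
  \<comment> \<open>One criterion serves both phases: the Euclidean norm of a configuration is at
    most the sum of the norms of its pieces.\<close>
  have near: "x \<in> U" if "\<And>i. norm (x $ i - w $ i) \<le> norm (u i) + norm (v i)" for x
  proof -
    have "norm (x - w) \<le> (\<Sum>i\<in>UNIV. norm ((x - w) $ i))"
      by (rule norm_le_sum_norm_nth)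
    also have "\<dots> \<le> (\<Sum>i\<in>UNIV. norm (u i) + norm (v i))"
      by (rule sum_mono) (simp only: vector_minus_component that)
    finally have "norm (x - w) \<le> (\<Sum>i\<in>UNIV. norm (u i) + norm (v i))" .
    then have "x \<in> ball w e"
      using small by (simp add: dist_norm norm_minus_commute u_def v_def)
    then show ?thesis using ball by blast
  qed
  have "(w, w1) \<in> (legal_step_rel M s U)\<^sup>*"
    unfolding w1_def u_def
    by (rule legal_steps_all_pieces[OF m(1)], rule near) (simp add: u_def)
  moreover have "(w1, \<chi> i. w1 $ i + v i) \<in> (legal_step_rel M s U)\<^sup>*"
    unfolding v_def
  proof (rule legal_steps_all_pieces[OF m(2)], rule near)
    fix A i
    show "norm ((\<chi> i. w1 $ i + (if i \<in> A then (real_of_int (b i) / real s) *\<^sub>R move_vec m2 else 0)) $ i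
        - w $ i) \<le> norm (u i) + norm (v i)"
      using norm_triangle_ineq[of "u i" "(real_of_int (b i) / real s) *\<^sub>R move_vec m2"]
      by (cases "i \<in> A") (simp_all add: w1_def v_def)
  qed
  ultimately show ?thesis
    by (simp add: w1_def u_def v_def)
qed

section \<open>Cramer's rule and the discretisation of a segment\<close>

lemma cramer_move_vec:
  fixes m1 m2 v :: "int ^ 2"
  defines "D \<equiv> m1 $ 1 * m2 $ 2 - m1 $ 2 * m2 $ 1"
  assumes "D \<noteq> 0"
  obtains a b :: int where
    "move_vec v = (real_of_int a / real (nat \<bar>D\<bar>)) *\<^sub>R move_vec m1 +
      (real_of_int b / real (nat \<bar>D\<bar>)) *\<^sub>R move_vec m2"
proof
  \<comment> \<open>These are the Cramer numerators \<open>det(v, m2)\<close> and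
    \<open>det(m1, v)\<close>, with \<open>D = det(m1, m2)\<close>.\<close>
  define a b where "a = v $ 1 * m2 $ 2 - v $ 2 * m2 $ 1" and "b = m1 $ 1 * v $ 2 - m1 $ 2 * v $ 1"
  have "D * v $ k = a * m1 $ k + b * m2 $ k" for k
    using exhaust_2[of k] by (auto simp: D_def a_def b_def algebra_simps)
  then have "real_of_int (v $ k) =
      real_of_int a / real_of_int D * real_of_int (m1 $ k) +
      real_of_int b / real_of_int D * real_of_int (m2 $ k)" for k
    using assms(2) by (simp add: field_simps flip: of_int_mult of_int_add)
  \<comment> \<open>Lattice denominators are natural numbers, so the sign of \<open>D\<close> is
    absorbed into the integer numerators.\<close>
  moreover have "real_of_int (sgn D * x) / real (nat \<bar>D\<bar>) = real_of_int x / real_of_int D" for x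
    using assms(2) by (cases "D > 0") (auto simp: sgn_if)
  ultimately show "move_vec v = (real_of_int (sgn D * a) / real (nat \<bar>D\<bar>)) *\<^sub>R move_vec m1 +
      (real_of_int (sgn D * b) / real (nat \<bar>D\<bar>)) *\<^sub>R move_vec m2"
    by (simp add: move_vec_def vec_eq_iff)
qed

lemma det_nonzero_if_not_parallel:
  fixes m1 m2 :: "int ^ 2"
  assumes "m1 \<noteq> 0" and np: "\<not> (\<exists>r::real. move_vec m2 = r *\<^sub>R move_vec m1)"
  shows "m1 $ 1 * m2 $ 2 - m1 $ 2 * m2 $ 1 \<noteq> 0"
proof
  assume "m1 $ 1 * m2 $ 2 - m1 $ 2 * m2 $ 1 = 0"
  then have eq: "m1 $ i * m2 $ j = m1 $ j * m2 $ i" for i j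
    using exhaust_2[of i] exhaust_2[of j] by (auto simp: algebra_simps)
  obtain k where k: "m1 $ k \<noteq> 0"
    using assms(1) by (auto simp: vec_eq_iff)
  \<comment> \<open>The vanishing determinant makes the coordinates proportional; the scalar is
    their ratio at a coordinate where \<open>m1\<close> is nonzero.\<close>
  have "move_vec m2 = (real_of_int (m2 $ k) / real_of_int (m1 $ k)) *\<^sub>R move_vec m1"
    unfolding move_vec_def vec_eq_iff
    using k eq[of k] by (auto simp: field_simps simp flip: of_int_mult)
  then show False using np by blast
qed

lemma legal_steps_along_segment:
  fixes z z' :: "('q::{finite,linorder}) config"
  assumes M: "basic_move_set M" "card M \<ge> 2"
    and lattice: "\<forall>i. z $ i \<in> refined_lattice 1" "\<forall>i. z' $ i \<in> refined_lattice 1"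
    and U: "open U" "closed_segment z z' \<subseteq> U"
  obtains s where "s > 0" "(z, z') \<in> (legal_step_rel M s U)\<^sup>*"
proof -
  obtain m1 m2 where m: "m1 \<in> M" "m2 \<in> M" "m1 \<noteq> m2"
    using M(2) by (metis card_le_Suc0_iff_eq card.infinite not_less_eq_eq numeral_2_eq_2 zero_le)
  define d where "d = nat \<bar>m1 $ 1 * m2 $ 2 - m1 $ 2 * m2 $ 1\<bar>"
  have det: "m1 $ 1 * m2 $ 2 - m1 $ 2 * m2 $ 1 \<noteq> 0"
    using M(1) m unfolding basic_move_set_def by (intro det_nonzero_if_not_parallel) blast+
  then have d: "d > 0" by (simp add: d_def)
  have "\<exists>a b. z' $ i - z $ i = (real_of_int a / real d) *\<^sub>R move_vec m1 +
      (real_of_int b / real d) *\<^sub>R move_vec m2" for i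
  proof -
    obtain v v' where "z $ i = move_vec v" "z' $ i = move_vec v'"
      using lattice by (fastforce simp: refined_lattice_def)
    then have "z' $ i - z $ i = move_vec (v' - v)"
      by (simp add: move_vec_diff)
    then show ?thesis
      using cramer_move_vec[OF det, of "v' - v"] unfolding d_def by metis
  qed
  then obtain a b where ab: "\<And>i. z' $ i - z $ i = (real_of_int (a i) / real d) *\<^sub>R move_vec m1 +
      (real_of_int (b i) / real d) *\<^sub>R move_vec m2"
    by metis
  \<comment> \<open>Compactness of the segment gives one radius for all its points, so the fineness
    \<open>n\<close> can be chosen before the subdivision points.\<close>
  obtain e where e: "e > 0" "(\<Union>x\<in>closed_segment z z'. ball x e) \<subseteq> U"
    using compact_subset_open_imp_ball_epsilon_subset[OF compact_segment U] by blast
  \<comment> \<open>\<open>c\<close> bounds the deviation if the segment were covered in one go;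
    cutting it into \<open>n\<close> parts scales this bound to \<open>c / n\<close>.\<close>
  define c where "c = (\<Sum>i\<in>UNIV. norm ((real_of_int (a i) / real d) *\<^sub>R move_vec m1) +
      norm ((real_of_int (b i) / real d) *\<^sub>R move_vec m2))"
  obtain n :: nat where "c / e < real n"
    using reals_Archimedean2 by blast
  \<comment> \<open>This forces \<open>n > 0\<close>, also when no piece has to move.\<close>
  moreover have "0 \<le> c / e"
    using e(1) by (simp add: c_def sum_nonneg)
  ultimately have "0 < real n" "c < e * real n"
    using e(1) by (linarith, simp add: field_simps)
  then have n: "n > 0" "c / real n < e"
    by (simp_all add: field_simps)
  \<comment> \<open>Dividing the coefficients \<open>a i / d\<close> and \<open>b i / d\<close> by
    \<open>n\<close> leaves the integers unchanged, so every part uses the same moves on the lattice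
    of denominator \<open>n * d\<close>.\<close>
  define s where "s = n * d"
  define p where "p k = z + (real k / real n) *\<^sub>R (z' - z)" for k :: nat
  have "(z, p k) \<in> (legal_step_rel M s U)\<^sup>*" if "k \<le> n" for k
    using that
  proof (induction k)
    case 0
    then show ?case by (simp add: p_def)
  next
    case (Suc k)
    have "p k \<in> closed_segment z z'"
      using Suc.prems unfolding in_segment p_def
      by (intro exI[of _ "real k / real n"]) (simp add: algebra_simps)
    then have "ball (p k) e \<subseteq> U" using e(2) by blast
    moreover have "(\<Sum>i\<in>UNIV. norm ((real_of_int (a i) / real s) *\<^sub>R move_vec m1) +
        norm ((real_of_int (b i) / real s) *\<^sub>R move_vec m2)) = c / real n"
      by (simp add: c_def s_def sum_divide_distrib add_divide_distrib mult_ac)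
    moreover have "(\<chi> i. p k $ i + (real_of_int (a i) / real s) *\<^sub>R move_vec m1 +
        (real_of_int (b i) / real s) *\<^sub>R move_vec m2) = p (Suc k)"
    proof -
      have "p (Suc k) $ i = p k $ i + (1 / real n) *\<^sub>R (z' $ i - z $ i)" for i
        by (simp add: p_def add_divide_distrib scaleR_add_left)
      then show ?thesis
        by (simp add: vec_eq_iff ab s_def scaleR_add_right mult_ac)
    qed
    ultimately have "(p k, p (Suc k)) \<in> (legal_step_rel M s U)\<^sup>*"
      using legal_steps_two_moves[OF m(1,2), of "p k" e U a s b] n(2) by simp
    then show ?case using Suc by (meson Suc_leD rtrancl_trans)
  qed
  from this[of n] have "(z, z') \<in> (legal_step_rel M s U)\<^sup>*"
    using n(1) by (simp add: p_def)
  moreover have "s > 0" using n d by (simp add: s_def)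
  ultimately show ?thesis using that by blast
qed

text \<open>Membership in the intersection supplies the type and the board, moves preserve the
  lattice, and the nonattacking property follows from the type.\<close>

lemma discretely_isotopic_if_legal_steps:
  fixes z z' :: "('q::{finite,linorder}) config"
  assumes z: "z \<in> nonattacking_configs M B t" and s: "s > 0"
    and steps: "(z, z') \<in> (legal_step_rel M s (type_cell M z \<inter> {w. \<forall>i. w $ i \<in> open_board t B}))\<^sup>*"
  shows "discretely_isotopic M B t z z'"
proof -
  let ?U = "type_cell M z \<inter> {w. \<forall>i. w $ i \<in> open_board t B}"
  obtain l w where w: "w 0 = z" "w l = z'"
    "\<And>h. h < l \<Longrightarrow> (w h, w (Suc h)) \<in> legal_step_rel M s ?U"
    using rtrancl_imp_relpow[OF steps] unfolding relpow_fun_conv by blast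
  have inv: "w h \<in> ?U \<and> (\<forall>i. w h $ i \<in> refined_lattice s)" if "h \<le> l" for h
    using that
  proof (induction h)
    \<comment> \<open>The relation constrains only targets, so the start is treated by itself; its
      integer points lie on every refined lattice.\<close>
    case 0
    then show ?case
      using z refined_lattice_1_subset[OF s]
      by (auto simp: w(1) type_cell_def nonattacking_configs_def)
  next
    case (Suc h)
    then have "legal_step M s (w h) (w (Suc h))" "w (Suc h) \<in> ?U"
      using w(3)[of h] by (simp_all add: legal_step_rel_def)
    then show ?case
      using legal_step_refined_lattice Suc by (meson Suc_leD)
  qed
  have "nonattacking M z" using z by (simp add: nonattacking_configs_def)
  then have "nonattacking M (w h) \<and> (\<forall>i. w h $ i \<in> open_board t B \<inter> refined_lattice s) \<and>
      comb_type M (w h) = comb_type M z" if "h \<le> l" for h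
    using nonattacking_comb_type_cong[of M z "w h"] inv[OF that] by (simp add: type_cell_def)
  moreover have "legal_step M s (w h) (w (Suc h))" if "h < l" for h
    using w(3)[OF that] by (simp add: legal_step_rel_def)
  ultimately show ?thesis
    unfolding discretely_isotopic_def using s w(1,2) by blast
qed

section \<open>The open board and the comparison of the two relations\<close>

lemma convex_open_board:
  assumes "convex B"
  shows "convex (open_board t B)"
  unfolding open_board_def by (intro convex_scaling convex_interior assms)

lemma open_open_board:
  assumes "t > 0"
  shows "open (open_board t B)"
  unfolding open_board_def using assms by (intro open_scaling) auto

text \<open>An isotopy may leave the board, whereas a discrete isotopy may not. Both amount to
  equality of types: the type cell and \<open>?K\<close> are convex and open, so their intersection
  contains the segment from \<open>z\<close> to \<open>z'\<close> and can serve as the neighbourhood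
  for the discretisation.\<close>

lemma isotopic_iff_discretely_isotopic:
  fixes z z' :: "('q::{finite,linorder}) config"
  assumes M: "basic_move_set M" "card M \<ge> 2" and B: "convex B" and t: "t > 0"
    and z: "z \<in> nonattacking_configs M B t" and z': "z' \<in> nonattacking_configs M B t"
  shows "isotopic M z z' \<longleftrightarrow> discretely_isotopic M B t z z'"
proof -
  have na: "nonattacking M z" using z by (simp add: nonattacking_configs_def)
  let ?K = "{w :: 'q config. \<forall>i. w $ i \<in> open_board t B}"
  have K: "?K = (\<Inter>i. (\<lambda>w. w $ i) -` open_board t B)" by auto
  have "open ?K"
    unfolding K by (intro open_INT ballI open_vimage_vec_nth open_open_board t) simp
  have "convex ?K"
    unfolding K
    by (intro convex_INT convex_linear_vimage convex_open_board B bounded_linear.linear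
        bounded_linear_vec_nth)
  show ?thesis
  proof
    assume "isotopic M z z'"
    then have "z' \<in> type_cell M z"
      using isotopic_iff_comb_type_eq[OF na] by (simp add: type_cell_def)
    then have "closed_segment z z' \<subseteq> type_cell M z \<inter> ?K"
      using z z' by (intro closed_segment_subset convex_Int convex_type_cell na \<open>convex ?K\<close>)
        (auto simp: type_cell_def nonattacking_configs_def)
    moreover have "open (type_cell M z \<inter> ?K)"
      using M(1) by (intro open_Int open_type_cell na \<open>open ?K\<close>) (simp add: basic_move_set_def)
    ultimately obtain s where "s > 0" "(z, z') \<in> (legal_step_rel M s (type_cell M z \<inter> ?K))\<^sup>*"
      using legal_steps_along_segment[OF M, of z z' "type_cell M z \<inter> ?K"] z z'
      by (auto simp: nonattacking_configs_def)
    then show "discretely_isotopic M B t z z'"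
      using discretely_isotopic_if_legal_steps[OF z] by blast
  next
    assume "discretely_isotopic M B t z z'"
    \<comment> \<open>This is the type condition at the last index \<open>h = l\<close>.\<close>
    then have "comb_type M z' = comb_type M z"
      unfolding discretely_isotopic_def by auto
    then show "isotopic M z z'"
      using isotopic_iff_comb_type_eq[OF na] by blast
  qed
qed

text \<open>Isotopy is equality of combinatorial types, which makes the equivalence laws immediate
  without reversing or joining paths.\<close>

lemma equiv_isotopy_rel:
  "equiv (nonattacking_configs M B t) (isotopy_rel M B t)"
proof -
  have "isotopy_rel M B t = {(z, z'). z \<in> nonattacking_configs M B t \<and>
      z' \<in> nonattacking_configs M B t \<and> comb_type M z' = comb_type M z}"
    unfolding isotopy_rel_def
    using isotopic_iff_comb_type_eq by (auto simp: nonattacking_configs_def)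
  then show ?thesis
    by (auto intro!: equivI refl_onI symI transI)
qed

theorem theorem5p4:
  fixes M :: "(int ^ 2) set" and B :: "(real ^ 2) set" and t :: nat
  assumes "basic_move_set M" and "card M \<ge> 2"
    and "rational_convex_polygon B" and "t > 0"
  shows "(\<forall>z \<in> nonattacking_configs M B t.
            \<forall>z' \<in> (nonattacking_configs M B t :: ('q::{finite,linorder}) config set).
              isotopic M z z' \<longleftrightarrow> discretely_isotopic M B t z z') \<and>
         equiv (nonattacking_configs M B t) (isotopy_rel M B t :: 'q config rel) \<and>
         (isotopy_rel M B t :: 'q config rel) = discrete_isotopy_rel M B t"
proof -
  have "convex B"
    using assms(3) by (simp add: rational_convex_polygon_def polytope_imp_convex)
  then have *: "isotopic M z z' \<longleftrightarrow> discretely_isotopic M B t z z'"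
    if "z \<in> nonattacking_configs M B t" "z' \<in> nonattacking_configs M B t" for z z' :: "'q config"
    using isotopic_iff_discretely_isotopic assms that by blast
  then have "(isotopy_rel M B t :: 'q config rel) = discrete_isotopy_rel M B t"
    unfolding isotopy_rel_def discrete_isotopy_rel_def by blast
  then show ?thesis
    using * equiv_isotopy_rel by blast
qed

end
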